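(* Let $S$ be a $(v,k,\mu)$ sum set in a finite group $G$ of order $v$, and let $n = k^2 - \mu v$. If $G$ has a normal subgroup of index $2$, then $n$ is the square of an integer. In particular, if $k$ is odd, then $n$ is a nonzero square.
   Context: For $a \in G$, the number of ways to write $a$ as a product in $S$ is the number of ordered pairs $(x,y) \in S\times S$ with $xy = a$. $S$ with $|S|=k$ is a $(v,k,\mu)$ sum set if every nonidentity element of $G$ can be written as a product in $S$ in exactly $\mu$ ways. *)

theory Defs
  imports "HOL-Algebra.Coset"
begin

definition num_products :: "('a, 'b) monoid_scheme \<Rightarrow> 'a set \<Rightarrow> 'a \<Rightarrow> nat" where
  "num_products G S a = card {(x, y). x \<in> S \<and> y \<in> S \<and> x \<otimes>\<^bsub>G\<^esub> y = a}"

(* Finiteness is required explicitly because card (hence order) of an infinite set is 0. *)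
definition sum_set :: "('a, 'b) monoid_scheme \<Rightarrow> nat \<Rightarrow> nat \<Rightarrow> nat \<Rightarrow> 'a set \<Rightarrow> bool" where
  "sum_set G v k \<mu> S \<longleftrightarrow>
     finite (carrier G) \<and> order G = v \<and> S \<subseteq> carrier G \<and> card S = k \<and>
     (\<forall>a \<in> carrier G - {\<one>\<^bsub>G\<^esub>}. num_products G S a = \<mu>)"

end

(* The sign character \<chi> with kernel N is orthogonal to the trivial character. Summing \<chi> over the
   products in S therefore gives (\<Sum>x\<in>S. \<chi> x)^2 = d - \<mu>, where d counts the ways to write the
   identity, while counting all pairs gives k^2 = d + \<mu> (v - 1); hence n = (\<Sum>x\<in>S. \<chi> x)^2.
   A sum of k signs has the parity of k. *)
theory Submission
  imports Defs
begin

text \<open>With only two right cosets, all elements outside \<open>H\<close> share one coset. If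
  \<open>x\<close> and \<open>y\<close> both lie outside, then so does \<open>inv y\<close>, hence
  \<open>x\<close> = \<open>h \<otimes> inv y\<close> with \<open>h\<close> in \<open>H\<close>, and
  the product is \<open>h\<close>. The other cases are closure and cancellation in
  \<open>H\<close>.\<close>

lemma (in group) index_2_mult_mem_iff:
  assumes H: "subgroup H G" and index: "card (rcosets H) = 2"
    and x: "x \<in> carrier G" and y: "y \<in> carrier G"
  shows "x \<otimes> y \<in> H \<longleftrightarrow> (x \<in> H \<longleftrightarrow> y \<in> H)"
proof -
  interpret H: subgroup H G by (fact H)
  have same_coset: "H #> x = H #> inv y" if "x \<notin> H" "y \<notin> H"
  proof (rule ccontr)
    assume neq: "H #> x \<noteq> H #> inv y"
    have "inv y \<notin> H"
      using that y H.m_inv_closed by fastforce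
    then have "inv y \<in> H #> inv y" "x \<in> H #> x" "inv y \<notin> H" "x \<notin> H"
      using that x y H rcos_self by auto
    \<comment> \<open>\<open>H\<close> differs from the other two cosets because each of them
      contains an element outside \<open>H\<close>; a third coset contradicts index 2.\<close>
    then have "card {H, H #> x, H #> inv y} = 3"
      using neq by (auto simp: card_insert_if)
    moreover have "{H, H #> x, H #> inv y} \<subseteq> rcosets H"
      using rcosetsI[OF H.subset x] rcosetsI[OF H.subset inv_closed[OF y]]
        H.subgroup_in_rcosets[OF is_group] by blast
    moreover have "finite (rcosets H)"
      using index card.infinite by fastforce
    ultimately have "3 \<le> card (rcosets H)"
      by (metis card_mono)
    then show False
      using index by simp
  qed
  show ?thesis
  proof (cases "x \<in> H \<or> y \<in> H")
    case True
    have y_eq: "inv x \<otimes> (x \<otimes> y) = y" and x_eq: "x \<otimes> y \<otimes> inv y = x"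
      using x y by (simp_all add: inv_solve_left' m_assoc)
    have "y \<in> H" if "x \<in> H" "x \<otimes> y \<in> H"
      using H.m_closed[OF H.m_inv_closed[OF that(1)] that(2)] y_eq by simp
    moreover have "x \<in> H" if "y \<in> H" "x \<otimes> y \<in> H"
      using H.m_closed[OF that(2) H.m_inv_closed[OF that(1)]] x_eq by simp
    ultimately show ?thesis
      using True H.m_closed by blast
  next
    case False
    then have "x \<in> H #> inv y"
      using same_coset x H rcos_self by auto
    then obtain h where "h \<in> H" "x = h \<otimes> inv y"
      by (auto simp: r_coset_def)
    then have "x \<otimes> y = h"
      using y by (simp add: m_assoc)
    then show ?thesis
      using False \<open>h \<in> H\<close> by simp
  qed
qed

text \<open>When \<open>H\<close> is a subgroup of index 2, this is the character with kernel
  \<open>H\<close>. It takes values in \<open>int\<close> so that its sum over a finite set is an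
  integer, to be squared and tested for parity.\<close>

definition index_2_sign :: "'a set \<Rightarrow> 'a \<Rightarrow> int" where
  "index_2_sign H x = (if x \<in> H then 1 else -1)"

lemma (in group) index_2_sign_mult:
  assumes "subgroup H G" "card (rcosets H) = 2" "x \<in> carrier G" "y \<in> carrier G"
  shows "index_2_sign H (x \<otimes> y) = index_2_sign H x * index_2_sign H y"
  using index_2_mult_mem_iff[OF assms] by (auto simp: index_2_sign_def)

text \<open>By Lagrange, \<open>H\<close> is exactly half of the group, so the signs cancel.\<close>

lemma (in group) sum_index_2_sign_carrier:
  assumes H: "subgroup H G" and index: "card (rcosets H) = 2" and fin: "finite (carrier G)"
  shows "(\<Sum>x\<in>carrier G. index_2_sign H x) = 0"
proof -
  have sub: "H \<subseteq> carrier G"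
    using H by (rule subgroup.subset)
  have "(\<Sum>x\<in>carrier G. index_2_sign H x)
      = (\<Sum>x\<in>H. index_2_sign H x) + (\<Sum>x\<in>carrier G - H. index_2_sign H x)"
    using sum.subset_diff[OF sub fin] by (simp add: add.commute)
  also have "\<dots> = int (card H) - int (card (carrier G - H))"
    by (simp add: index_2_sign_def)
  also have "card (carrier G - H) = card H"
    using lagrange[OF H] index sub fin
    by (simp add: order_def card_Diff_subset finite_subset)
  finally show ?thesis by simp
qed

text \<open>Every sign is odd, so each inserted element flips both parities.\<close>

lemma even_sum_index_2_sign_iff:
  assumes "finite S"
  shows "even (\<Sum>x\<in>S. index_2_sign H x) \<longleftrightarrow> even (card S)"
  using assms by (induction S rule: finite_induct) (auto simp: index_2_sign_def)

text \<open>Group the pairs by their product: \<open>f\<close> is constant on each fibre, and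
  \<open>num_products\<close> is the size of the fibre.\<close>

lemma (in group) sum_products:
  fixes f :: "'a \<Rightarrow> int"
  assumes fin: "finite (carrier G)" and S: "S \<subseteq> carrier G"
  shows "(\<Sum>x\<in>S. \<Sum>y\<in>S. f (x \<otimes> y)) = (\<Sum>a\<in>carrier G. int (num_products G S a) * f a)"
proof -
  let ?fib = "\<lambda>a. {p \<in> S \<times> S. fst p \<otimes> snd p = a}"
  have finS: "finite S" using S fin by (rule finite_subset)
  have "(\<Sum>x\<in>S. \<Sum>y\<in>S. f (x \<otimes> y)) = (\<Sum>p\<in>S \<times> S. f (fst p \<otimes> snd p))"
    by (simp add: sum.cartesian_product case_prod_beta)
  also have "\<dots> = (\<Sum>a\<in>carrier G. \<Sum>p\<in>?fib a. f (fst p \<otimes> snd p))"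
    using finS fin S by (intro sum.group[symmetric]) (auto simp: subset_iff)
  also have "\<dots> = (\<Sum>a\<in>carrier G. int (num_products G S a) * f a)"
  proof (rule sum.cong[OF refl])
    fix a
    have "num_products G S a = card (?fib a)"
      unfolding num_products_def by (rule arg_cong[of _ _ card]) auto
    then show "(\<Sum>p\<in>?fib a. f (fst p \<otimes> snd p)) = int (num_products G S a) * f a"
      by simp
  qed
  finally show ?thesis .
qed

text \<open>This is the group ring identity S^2 = (d - \<mu>) 1 + \<mu> G, with d the number of ways
  to write the identity, after applying \<open>f\<close> linearly. It is stated for arbitrary
  \<open>f\<close> so that both the trivial and the sign character can be substituted.\<close>

lemma (in group) sum_set_sum_products:
  fixes f :: "'a \<Rightarrow> int"
  assumes "sum_set G v k \<mu> S"
  shows "(\<Sum>x\<in>S. \<Sum>y\<in>S. f (x \<otimes> y))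
    = (int (num_products G S \<one>) - int \<mu>) * f \<one> + int \<mu> * (\<Sum>a\<in>carrier G. f a)"
proof -
  have fin: "finite (carrier G)" and S: "S \<subseteq> carrier G"
    and count: "\<forall>a \<in> carrier G - {\<one>}. num_products G S a = \<mu>"
    using assms by (auto simp: sum_set_def)
  have "(\<Sum>x\<in>S. \<Sum>y\<in>S. f (x \<otimes> y)) = int (num_products G S \<one>) * f \<one>
      + (\<Sum>a\<in>carrier G - {\<one>}. int (num_products G S a) * f a)"
    by (simp only: sum_products[OF fin S] sum.remove[OF fin one_closed])
  also have "(\<Sum>a\<in>carrier G - {\<one>}. int (num_products G S a) * f a)
      = int \<mu> * (\<Sum>a\<in>carrier G - {\<one>}. f a)"
    using count by (simp add: sum_distrib_left)
  also have "(\<Sum>a\<in>carrier G - {\<one>}. f a) = (\<Sum>a\<in>carrier G. f a) - f \<one>"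
    by (simp add: sum.remove[OF fin one_closed])
  finally show ?thesis by (simp add: algebra_simps)
qed

theorem theorem3p5:
  fixes G :: "('a, 'b) monoid_scheme" and S :: "'a set" and v k \<mu> :: nat and n :: int
  assumes "group G" and "finite (carrier G)" and "order G = v"
    and "sum_set G v k \<mu> S"
    and "n = (int k)\<^sup>2 - int \<mu> * int v"
    and "\<exists>N. N \<lhd> G \<and> card (rcosets\<^bsub>G\<^esub> N) = 2"
  shows "(\<exists>m :: int. n = m\<^sup>2) \<and> (odd k \<longrightarrow> (\<exists>m :: int. n = m\<^sup>2 \<and> n \<noteq> 0))"
proof -
  interpret group G by (fact assms(1))
  obtain N where "N \<lhd> G" and index: "card (rcosets\<^bsub>G\<^esub> N) = 2"
    using assms(6) by blast
  then have N: "subgroup N G"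
    by (simp add: normal_imp_subgroup)
  have S: "S \<subseteq> carrier G" "card S = k"
    using assms(4) by (auto simp: sum_set_def)
  define m where "m = (\<Sum>x\<in>S. index_2_sign N x)"
  \<comment> \<open>The trivial character counts all pairs in \<open>S\<close>; its sum over the
    group is \<open>v\<close>.\<close>
  have "(int k)\<^sup>2 = int (num_products G S \<one>\<^bsub>G\<^esub>) - int \<mu> + int \<mu> * int v"
    using sum_set_sum_products[OF assms(4), of "\<lambda>_. 1"] S assms(3)
    by (simp add: order_def power2_eq_square)
  then have n: "n = int (num_products G S \<one>\<^bsub>G\<^esub>) - int \<mu>"
    using assms(5) by simp
  \<comment> \<open>Multiplicativity of the sign turns the product of two sums into a sum over
    products.\<close>
  have "m\<^sup>2 = (\<Sum>x\<in>S. \<Sum>y\<in>S. index_2_sign N (x \<otimes>\<^bsub>G\<^esub> y))"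
    unfolding m_def power2_eq_square sum_product
    using S by (intro sum.cong refl) (auto simp: index_2_sign_mult[OF N index] subset_iff)
  \<comment> \<open>The sum of the sign over the group vanishes and the sign of the identity is 1,
    so only d - \<mu> survives.\<close>
  also have "\<dots> = n"
    using subgroup.one_closed[OF N]
    unfolding sum_set_sum_products[OF assms(4)] sum_index_2_sign_carrier[OF N index assms(2)] n
    by (simp add: index_2_sign_def)
  finally have square: "n = m\<^sup>2" by simp
  have "even m \<longleftrightarrow> even k"
    unfolding m_def using even_sum_index_2_sign_iff S assms(2) finite_subset by blast
  \<comment> \<open>For odd \<open>k\<close> the integer \<open>m\<close> is odd, hence nonzero, and
    so is its square.\<close>
  then have "n \<noteq> 0" if "odd k"
    using that square by auto
  then show ?thesis
    using square by blast
qed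

end
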